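(* The function $\mathrm{EQ} \colon 2^{\mathbb{N}} \times 2^{\mathbb{N}} \to \{0,1\}$ defined by $\mathrm{EQ}(x,y) = 1$ if $x = y$ and $\mathrm{EQ}(x,y) = 0$ otherwise has no communication protocol.
   Context: Infinite communication protocols. Let $X = Y = 2^{\mathbb{N}}$ (infinite binary strings) and let $Z$ be a countable set. A protocol $P$ is a countable, well-founded (no infinite branch) rooted tree in which each internal node $v$ is labeled either by a function $a_v \colon X \to \mathbb{N}$ (Alice's node) or by a function $b_v \colon Y \to \mathbb{N}$ (Bob's node), these functions being arbitrary, and each leaf is labeled by an element of $Z$. Every edge is labeled with some natural number, and for each internal node $v$ and each $n$ in the range of $a_v$ (resp. $b_v$), exactly one edge from $v$ to one of its children is labeled $n$. The protocol computes a function $P \colon X \times Y \to Z$: on input $(x,y)$ start at the root; at an internal node $v$ follow the edge labeled $a_v(x)$ (if $v$ is Alice's) or $b_v(y)$ (if $v$ is Bob's); output the label of the leaf eventually reached. A function $f \colon X \times Y \to Z$ has a communication protocol if some protocol computes $f$. *)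

theory Defs
  imports "HOL-Library.Countable_Set"
begin

type_synonym cantor = "nat \<Rightarrow> bool"

datatype query = Alice "cantor \<Rightarrow> nat" | Bob "cantor \<Rightarrow> nat"

primrec query_range :: "query \<Rightarrow> nat set" where
  "query_range (Alice a) = range a"
| "query_range (Bob b) = range b"

primrec answer :: "query \<Rightarrow> cantor \<Rightarrow> cantor \<Rightarrow> nat" where
  "answer (Alice a) x y = a x"
| "answer (Bob b) x y = b y"

text \<open>Edges point from parent to child. The field \<open>query_of\<close> is meaningful on internal nodes only,
  \<open>leaf_label\<close> on leaves only, and \<open>edge_label\<close> on edges only; elsewhere their values are irrelevant.\<close>

record ('v, 'z) labelled_tree =
  nodes :: "'v set"
  edges :: "('v \<times> 'v) set"
  root_node :: 'v
  query_of :: "'v \<Rightarrow> query"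
  edge_label :: "'v \<times> 'v \<Rightarrow> nat"
  leaf_label :: "'v \<Rightarrow> 'z"

definition internal_node :: "('v, 'z) labelled_tree \<Rightarrow> 'v \<Rightarrow> bool" where
  "internal_node P v \<longleftrightarrow> v \<in> nodes P \<and> (\<exists>w. (v, w) \<in> edges P)"

definition leaf :: "('v, 'z) labelled_tree \<Rightarrow> 'v \<Rightarrow> bool" where
  "leaf P v \<longleftrightarrow> v \<in> nodes P \<and> (\<nexists>w. (v, w) \<in> edges P)"

definition rooted_tree :: "('v, 'z) labelled_tree \<Rightarrow> bool" where
  "rooted_tree P \<longleftrightarrow>
     edges P \<subseteq> nodes P \<times> nodes P \<and>
     root_node P \<in> nodes P \<and>
     (\<nexists>u. (u, root_node P) \<in> edges P) \<and>
     (\<forall>v \<in> nodes P - {root_node P}. \<exists>!u. (u, v) \<in> edges P) \<and>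
     (\<forall>v \<in> nodes P. (root_node P, v) \<in> (edges P)\<^sup>*)"

text \<open>A node may also have children along edges whose labels lie outside the range of its query;
  such edges are unconstrained and never followed.\<close>

locale protocol =
  fixes Z :: "'z set" and P :: "('v, 'z) labelled_tree"
  assumes countable_Z: "countable Z"
    and tree: "rooted_tree P"
    and countable_nodes: "countable (nodes P)"
    and no_infinite_branch: "\<nexists>p. p 0 = root_node P \<and> (\<forall>i::nat. (p i, p (Suc i)) \<in> edges P)"
    and unique_edge: "\<And>v n. internal_node P v \<Longrightarrow> n \<in> query_range (query_of P v) \<Longrightarrow>
          \<exists>!w. (v, w) \<in> edges P \<and> edge_label P (v, w) = n"
    and leaf_label_in_Z: "\<And>v. leaf P v \<Longrightarrow> leaf_label P v \<in> Z"

inductive run :: "('v, 'z) labelled_tree \<Rightarrow> cantor \<Rightarrow> cantor \<Rightarrow> 'v \<Rightarrow> 'z \<Rightarrow> bool"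
  for P x y where
  leaf: "leaf P v \<Longrightarrow> run P x y v (leaf_label P v)"
| step: "internal_node P v \<Longrightarrow> (v, w) \<in> edges P \<Longrightarrow>
    edge_label P (v, w) = answer (query_of P v) x y \<Longrightarrow> run P x y w z \<Longrightarrow> run P x y v z"

definition computes :: "('v, 'z) labelled_tree \<Rightarrow> (cantor \<Rightarrow> cantor \<Rightarrow> 'z) \<Rightarrow> bool" where
  "computes P f \<longleftrightarrow> (\<forall>x y. run P x y (root_node P) (f x y))"

text \<open>HOL cannot quantify over the type of nodes inside a formula, hence the type argument. Every
  countable tree is isomorphic to one with nodes of type \<^typ>\<open>nat\<close>; non-existence is to be
  stated for a free type variable.\<close>

definition has_protocol :: "'v itself \<Rightarrow> 'z set \<Rightarrow> (cantor \<Rightarrow> cantor \<Rightarrow> 'z) \<Rightarrow> bool" where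
  "has_protocol _ Z f \<longleftrightarrow> (\<exists>P :: ('v, 'z) labelled_tree. protocol Z P \<and> computes P f)"

definition EQ :: "cantor \<Rightarrow> cantor \<Rightarrow> nat" where
  "EQ x y = (if x = y then 1 else 0)"

text \<open>In a protocol, \<^const>\<open>run\<close> from the root is the graph of a total function into \<open>Z\<close>.\<close>

lemma answer_in_query_range: "answer q x y \<in> query_range q"
  by (cases q) auto

context protocol
begin

lemma run_functional:
  assumes "run P x y v z" "run P x y v z'"
  shows "z = z'"
  using assms
proof (induction arbitrary: z' rule: run.induct)
  case (leaf v)
  from leaf(2) show ?case
    by cases (use leaf(1) in \<open>auto simp: internal_node_def leaf_def\<close>)
next
  case (step v w z)
  note IH = step.IH and vw = step.hyps(1-3)
  from step.prems show ?case
  proof cases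
    case leaf
    then show ?thesis using vw by (auto simp: internal_node_def leaf_def)
  next
    case (step w')
    have "w = w'"
      using unique_edge[OF vw(1) answer_in_query_range] vw(2,3) step(2,3) by blast
    then show ?thesis using IH step by blast
  qed
qed

lemma run_output: "run P x y v z \<Longrightarrow> z \<in> Z"
  by (induction rule: run.induct) (auto intro: leaf_label_in_Z)

lemma run_total: "\<exists>z. run P x y (root_node P) z"
proof (rule ccontr)
  assume stuck: "\<nexists>z. run P x y (root_node P) z"
  let ?bad = "\<lambda>v. v \<in> nodes P \<and> (\<nexists>z. run P x y v z)"
  have sub: "edges P \<subseteq> nodes P \<times> nodes P" and root: "root_node P \<in> nodes P"
    using tree by (auto simp: rooted_tree_def)
  have next_bad: "\<exists>w. ?bad w \<and> (v, w) \<in> edges P" if "?bad v" for v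
  proof -
    have int: "internal_node P v"
      using that run.leaf[of P v x y] by (auto simp: internal_node_def leaf_def)
    obtain w where w: "(v, w) \<in> edges P" "edge_label P (v, w) = answer (query_of P v) x y"
      using unique_edge[OF int answer_in_query_range] by blast
    then show ?thesis
      using that run.step[OF int w] sub by blast
  qed
  have "\<exists>p. \<forall>n. (?bad (p n) \<and> (n = 0 \<longrightarrow> p n = root_node P)) \<and> (p n, p (Suc n)) \<in> edges P"
    by (rule dependent_nat_choice) (use stuck root next_bad in auto)
  then show False using no_infinite_branch by blast
qed

lemma run_ex1: "\<exists>!z. run P x y (root_node P) z"
  using run_total run_functional by blast

end

end

theory Submission
  imports Defs
begin

text \<open>This is the fooling-set argument with ``countable'' in place of ``few''. In a tree the node
  at which a run has arrived determines all answers given so far, and each answer depends on one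
  of the two inputs only. Hence the inputs that visit a given node form a combinatorial rectangle
  (\<open>visits_rectangle\<close>). There are only countably many leaves, so among uncountably many input
  pairs two end at the same leaf, and then the two crossed pairs end there as well and receive
  the same output (\<open>uncountable_not_fooling\<close>).

  The diagonal of Cantor space is uncountable, so a protocol for equality would send \<open>(x, x)\<close> and
  \<open>(y, y)\<close> to the same leaf for some \<open>x \<noteq> y\<close>, and would declare \<open>x\<close> and \<open>y\<close> equal.\<close>

text \<open>The inductive \<^const>\<open>run\<close> grows from the leaf upwards and forgets where it ended. Rectangles
  are a statement about the node reached, with the root as the fixed end.\<close>

inductive visits :: "('v, 'z) labelled_tree \<Rightarrow> cantor \<Rightarrow> cantor \<Rightarrow> 'v \<Rightarrow> bool"
  for P x y where
  root: "visits P x y (root_node P)"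
| step: "visits P x y v \<Longrightarrow> internal_node P v \<Longrightarrow> (v, w) \<in> edges P \<Longrightarrow>
    edge_label P (v, w) = answer (query_of P v) x y \<Longrightarrow> visits P x y w"

lemma run_visits_leaf:
  assumes "run P x y v z" "visits P x y v"
  shows "\<exists>l. leaf P l \<and> visits P x y l"
  using assms by induction (auto intro: visits.step)

lemma visits_run_root:
  assumes "visits P x y v" "run P x y v z"
  shows "run P x y (root_node P) z"
  using assms by induction (auto intro: run.step)

text \<open>A query reads one coordinate only, so it cannot tell a crossed pair from both of the pairs
  it was crossed from.\<close>

lemma answer_crossed:
  assumes "answer q x y = n" "answer q x' y' = n"
  shows "answer q x y' = n"
  using assms by (cases q) auto

text \<open>Parents being unique, two runs that meet at a node have come along the same path, and
  \<open>answer_crossed\<close> applies at every node of it.\<close>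

lemma visits_rectangle:
  assumes tree: "rooted_tree P"
    and "visits P x y v" "visits P x' y' v"
  shows "visits P x y' v"
  using assms(2,3)
proof induction
  case root
  show ?case by (rule visits.root)
next
  case (step v w)
  from step.prems show ?case
  proof cases
    case root
    with step.hyps tree show ?thesis by (auto simp: rooted_tree_def)
  next
    case meet: (step u)
    have "w \<in> nodes P - {root_node P}"
      using tree \<open>(v, w) \<in> edges P\<close> by (auto simp: rooted_tree_def)
    with tree have "\<exists>!t. (t, w) \<in> edges P" unfolding rooted_tree_def by blast
    with \<open>(v, w) \<in> edges P\<close> \<open>(u, w) \<in> edges P\<close> have "u = v" by blast
    with meet have "edge_label P (v, w) = answer (query_of P v) x' y'" "visits P x' y' v" by simp_all
    then have "edge_label P (v, w) = answer (query_of P v) x y'"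
      using step.hyps answer_crossed by metis
    moreover have "visits P x y' v" using \<open>visits P x' y' v\<close> by (rule step.IH)
    ultimately show ?thesis
      using visits.step step.hyps(2,3) by metis
  qed
qed

context protocol
begin

lemma computes_at_leaf:
  assumes "computes P f" "leaf P l" "visits P x y l"
  shows "f x y = leaf_label P l"
proof (rule run_functional)
  show "run P x y (root_node P) (f x y)" using assms(1) by (simp add: computes_def)
  show "run P x y (root_node P) (leaf_label P l)"
    using assms(3) run.leaf[OF assms(2)] by (rule visits_run_root)
qed

text \<open>A fooling set is a set of input pairs on which the function is constant, but such that any
  two of them have a crossed pair with a different value. An uncountable set is never one.\<close>

lemma uncountable_not_fooling:
  assumes f: "computes P f" and S: "uncountable S"
  obtains x y x' y' where "(x, y) \<in> S" "(x', y') \<in> S" "(x, y) \<noteq> (x', y')"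
    "f x y = f x' y'" "f x y' = f x y" "f x' y = f x y"
proof -
  define L where "L = (\<lambda>(x, y). SOME l. leaf P l \<and> visits P x y l)"
  have L: "leaf P (L (x, y)) \<and> visits P x y (L (x, y))" for x y
  proof -
    have "run P x y (root_node P) (f x y)" using f by (simp add: computes_def)
    then have "\<exists>l. leaf P l \<and> visits P x y l" using visits.root by (rule run_visits_leaf)
    then show ?thesis unfolding L_def prod.case by (rule someI_ex)
  qed
  have "L ` S \<subseteq> nodes P" using L by (auto simp: leaf_def)
  then have "countable (L ` S)" using countable_nodes by (rule countable_subset)
  then have "\<not> inj_on L S" using S countable_image_inj_on by blast
  then obtain x y x' y' where pairs: "(x, y) \<in> S" "(x', y') \<in> S" "(x, y) \<noteq> (x', y')"
    and same: "L (x', y') = L (x, y)"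
    by (auto simp: inj_on_def)
  have l: "leaf P (L (x, y))" and v: "visits P x y (L (x, y))" "visits P x' y' (L (x, y))"
    using L[of x y] L[of x' y'] same by simp_all
  note out = computes_at_leaf[OF f l]
  show thesis
    using that[OF pairs] out[OF v(1)] out[OF v(2)]
      out[OF visits_rectangle[OF tree v]] out[OF visits_rectangle[OF tree v(2,1)]] by metis
qed

end

lemma uncountable_cantor: "uncountable (UNIV :: cantor set)"
proof
  assume countable: "countable (UNIV :: cantor set)"
  define e where "e = from_nat_into (UNIV :: cantor set)"
  have "surj e"
    unfolding e_def by (intro range_from_nat_into) (simp_all add: countable)
  then obtain n where "(\<lambda>k. \<not> e k k) = e n" by (rule surjE)
  then have "(\<not> e n n) = e n n" by (rule fun_cong)
  then show False by simp
qed

theorem corollary4p4: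
  shows "\<not> has_protocol TYPE('v) {0, 1} EQ"
proof
  assume "has_protocol TYPE('v) {0, 1} EQ"
  then obtain P :: "('v, nat) labelled_tree" where "protocol {0, 1} P" and P: "computes P EQ"
    unfolding has_protocol_def by blast
  interpret protocol "{0, 1}" P by fact
  have "uncountable (range (\<lambda>x :: cantor. (x, x)))"
    using uncountable_cantor countable_image_inj_on[of "\<lambda>x. (x, x)"] by (auto simp: inj_on_def)
  then show False
  proof (rule uncountable_not_fooling[OF P])
    fix x y x' y' :: cantor
    assume "(x, y) \<in> range (\<lambda>x. (x, x))" "(x', y') \<in> range (\<lambda>x. (x, x))"
      and "(x, y) \<noteq> (x', y')" "EQ x y' = EQ x y"
    then show False by (auto simp: EQ_def split: if_splits)
  qed
qed

end
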